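(* Let $k\in\{1,2\}$ and let $\bar k$ denote the other element of $\{1,2\}$. Let $X,Y$ be independent exponentially distributed random variables with means $1/\lambda_k$ and $1/\lambda_{\bar k}$ respectively, where $\lambda_k,\lambda_{\bar k}>0$. Let $\sigma_k^2>0$, $p_s>0$, $p_w>0$, $\alpha_k\in(0,1]$, and define $$R=\begin{cases}\alpha_k\log_2\Big(1+\dfrac{p_sX}{\alpha_k\sigma_k^2}\Big), & X>Y,\\[4pt] \alpha_k\log_2\Big(1+\dfrac{p_wX}{\alpha_k\sigma_k^2}\Big), & \text{otherwise.}\end{cases}$$ Then $$\mathbb E[R]=\frac{\alpha_k}{\ln2}\left(-f\Big(\frac{\lambda_k\alpha_k\sigma_k^2}{p_s}\Big)+\frac{\lambda_k}{\lambda_k+\lambda_{\bar k}}f\Big(\frac{(\lambda_k+\lambda_{\bar k})\alpha_k\sigma_k^2}{p_s}\Big)-\frac{\lambda_k}{\lambda_k+\lambda_{\bar k}}f\Big(\frac{(\lambda_k+\lambda_{\bar k})\alpha_k\sigma_k^2}{p_w}\Big)\right),$$ where $f(x)=e^x\,\mathrm{Ei}(-x)$ for $x>0$.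
   Context: $\mathrm{Ei}(x)=\int_{-\infty}^x\frac{e^t}{t}\,dt$ for $x<0$. Interpretation: $X=|h_k|^2$ and $Y=|h_{\bar k}|^2$ are the channel gains of users $k$ and $\bar k$ in a two-user downlink orthogonal multiple access scheme (OMA-Type-II) with equal noise variances; under partial channel state information the base station uses the fixed power $p_s$ for the currently stronger user and $p_w$ for the currently weaker user, user $k$ gets a fixed fraction $\alpha_k$ of the time/frequency resource, and $R$ is the instantaneous rate of user $k$. *)

theory Defs
  imports "HOL-Probability.Probability"
begin

(* Exponential integral; meaningful only for x < 0, where the integrand is
   absolutely integrable.  For x >= 0 the Lebesgue integral diverges and the
   value is the library default. *)
definition Ei :: "real \<Rightarrow> real" where
  "Ei x = (LBINT t:{..x}. exp t / t)"

definition exp_Ei :: "real \<Rightarrow> real" where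
  "exp_Ei x = exp x * Ei (- x)"

(* Instantaneous rate of a user with resource share a, noise variance v and own
   channel gain x, the other user's gain being y. *)
definition oma_rate :: "real \<Rightarrow> real \<Rightarrow> real \<Rightarrow> real \<Rightarrow> real \<Rightarrow> real \<Rightarrow> real" where
  "oma_rate a v p_s p_w x y =
     (if x > y then a * log 2 (1 + p_s * x / (a * v))
      else a * log 2 (1 + p_w * x / (a * v)))"

end

theory Submission
  imports Defs "HOL-Real_Asymp.Real_Asymp"
begin

text \<open>
  Since \<open>P(Y < x) = 1 - exp (- m x)\<close> and weighting the exponential density of rate \<open>l\<close> by
  \<open>exp (- m x)\<close> gives \<open>l / (l + m)\<close> times the density of rate \<open>l + m\<close>, Fubini expresses the
  mean rate through integrals of \<open>ln (1 + c x)\<close> against exponential densities. Integration by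
  parts followed by the affine substitution \<open>t = - b / c - b x\<close> identifies such an integral, for
  rate \<open>b\<close>, with \<open>- exp (b / c) Ei (- b / c)\<close>.
\<close>

text \<open>The function \<open>- (exp (- (x * b)) * ln (1 + c * x))\<close> is an antiderivative of
  the difference of the two integrands on the positive half-line and tends to 0 at both ends. Each
  integrand is shown integrable on its own, so that the vanishing integral of the difference can be
  split.\<close>

lemma exponential_integration_by_parts:
  fixes b c :: real
  assumes b: "b > 0" and c: "c > 0"
  shows integrable_exponential_density_ln:
      "integrable lborel (\<lambda>x. exponential_density b x * ln (1 + c * x))" (is "integrable _ ?f")
    and integral_exponential_density_ln:
      "(\<integral>x. exponential_density b x * ln (1 + c * x) \<partial>lborel) =
       (\<integral>x. exponential_density b x * (c / (b * (1 + c * x))) \<partial>lborel)"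
      (is "_ = integral\<^sup>L _ ?g")
proof -
  \<comment> \<open>A constant is integrable under the probability measure with this density, hence
    the density is integrable. Case k = 0 is the exponential density; k = 1 supplies an extra factor
    x.\<close>
  have int: "integrable lborel (erlang_density k b)" for k
  proof -
    interpret prob_space "density lborel (erlang_density k b)"
      by (rule prob_space_erlang_density[OF b])
    have "integrable (density lborel (erlang_density k b)) (\<lambda>_. 1 :: real)"
      by simp
    then show ?thesis
      using b by (subst (asm) integrable_real_density) auto
  qed
  have meas: "?f \<in> borel_measurable lborel" "?g \<in> borel_measurable lborel"
    by measurable
  \<comment> \<open>For x \<ge> 0 this bound equals \<open>b * exp (- (x * b)) * (c * x)\<close>,
    which dominates \<open>?f\<close> by ln (1 + u) \<le> u.\<close>
  have "integrable lborel (\<lambda>x. c / b * erlang_density 1 b x)"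
    using int by simp
  then show f: "integrable lborel ?f"
  proof (rule Bochner_Integration.integrable_bound[OF _ meas(1)], intro AE_I2)
    fix x
    have "b * exp (- (x * b)) * ln (1 + c * x) \<le> b * exp (- (x * b)) * (c * x)" if "x \<ge> 0"
      using that b c by (intro mult_left_mono ln_add_one_self_le_self) auto
    then show "norm (?f x) \<le> norm (c / b * erlang_density 1 b x)"
      using b c by (auto simp: erlang_density_def power2_eq_square abs_mult field_simps)
  qed
  have "integrable lborel (\<lambda>x. c / b * exponential_density b x)"
    using int by simp
  then have g: "integrable lborel ?g"
  proof (rule Bochner_Integration.integrable_bound[OF _ meas(2)], intro AE_I2)
    fix x
    have "c / (b * (1 + c * x)) \<le> c / b" if "x \<ge> 0"
      using that b c by (intro divide_left_mono) (auto intro!: mult_pos_pos add_pos_nonneg)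
    then have "exponential_density b x * (c / (b * (1 + c * x))) \<le> exponential_density b x * (c / b)"
      using mult_left_mono exponential_density_nonneg[OF b, of x]
      by (cases "x \<ge> 0") (blast, simp add: exponential_density_def)
    moreover have "?g x \<ge> 0"
      using b c by (auto simp: exponential_density_def)
    ultimately show "norm (?g x) \<le> norm (c / b * exponential_density b x)"
      unfolding real_norm_def mult.commute[of "c / b"] by linarith
  qed
  have "(LBINT x=0..\<infinity>. ?f x - ?g x) = 0 - 0"
  proof (rule interval_integral_FTC_integrable[where F = "\<lambda>x. - (exp (- (x * b)) * ln (1 + c * x))"])
    fix x :: real
    assume "0 < ereal x"
    then have x: "x > 0" by simp
    have pos: "1 + c * x > 0" using x c by (simp add: add_pos_pos)
    show "((\<lambda>x. - (exp (- (x * b)) * ln (1 + c * x))) has_vector_derivative (?f x - ?g x)) (at x)"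
      unfolding has_real_derivative_iff_has_vector_derivative[symmetric]
      using x pos b
      by (auto intro!: derivative_eq_intros simp: exponential_density_def)
    \<comment> \<open>The density is defined by cases at 0, so continuity is proved for the closed
      formula and transferred: the two agree on the open set of positive reals, a neighbourhood of
      x.\<close>
    have "isCont (\<lambda>x. b * exp (- (x * b)) * ln (1 + c * x)
            - b * exp (- (x * b)) * (c / (b * (1 + c * x)))) x"
      using pos b by (intro continuous_intros) auto
    moreover have "\<forall>\<^sub>F x in nhds x. b * exp (- (x * b)) * ln (1 + c * x)
            - b * exp (- (x * b)) * (c / (b * (1 + c * x))) = ?f x - ?g x"
      using eventually_nhds_in_open[of "{0<..}" x] x
      by (auto simp: exponential_density_def elim!: eventually_mono)
    ultimately show "isCont (\<lambda>x. ?f x - ?g x) x"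
      using isCont_cong by fastforce
  next
    show "set_integrable lborel (einterval 0 \<infinity>) (\<lambda>x. ?f x - ?g x)"
      unfolding set_integrable_def using f g
      by (intro integrable_mult_indicator) auto
  next
    have "((\<lambda>x. - (exp (- (x * b)) * ln (1 + c * x))) \<longlongrightarrow> - (exp (- (0 * b)) * ln (1 + c * 0))) (at_right 0)"
      by (intro tendsto_intros) auto
    then show "(((\<lambda>x. - (exp (- (x * b)) * ln (1 + c * x))) \<circ> real_of_ereal) \<longlongrightarrow> 0) (at_right 0)"
      unfolding zero_ereal_def by (simp add: ereal_tendsto_simps)
  next
    have "((\<lambda>x. - (exp (- (x * b)) * ln (1 + c * x))) \<longlongrightarrow> 0) at_top"
      using b c by real_asymp
    then show "(((\<lambda>x. - (exp (- (x * b)) * ln (1 + c * x))) \<circ> real_of_ereal) \<longlongrightarrow> 0) (at_left \<infinity>)"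
      by (simp add: ereal_tendsto_simps)
  qed simp
  then have "(LBINT x:{0<..}. ?f x - ?g x) = 0"
    by (simp add: interval_lebesgue_integral_0_infty)
  \<comment> \<open>The density vanishes on the negative reals, so only the null set {0} separates
    the two integrals.\<close>
  also have "(LBINT x:{0<..}. ?f x - ?g x) = (\<integral>x. ?f x - ?g x \<partial>lborel)"
    unfolding set_lebesgue_integral_def
    by (rule integral_cong_AE)
       (use AE_lborel_singleton[of 0] in \<open>auto elim!: eventually_mono
          simp: exponential_density_def split: split_indicator\<close>)
  finally show "integral\<^sup>L lborel ?f = integral\<^sup>L lborel ?g"
    using f g by simp
qed

text \<open>The substitution t = - b / c - b x maps x \<ge> 0 onto t \<le> - b / c, with t = - b (1
  + c x) / c and exp t = exp (- b / c) exp (- b x). The Jacobian factor b becomes the prefactor of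
  the density, and exp (- b / c) cancels against the exponential in \<open>exp_Ei\<close>.\<close>

lemma exp_Ei_eq_integral:
  fixes b c :: real
  assumes b: "b > 0" and c: "c > 0"
  shows "exp_Ei (b / c) = - (\<integral>x. exponential_density b x * (c / (b * (1 + c * x))) \<partial>lborel)"
proof -
  have "Ei (- (b / c)) = b * (\<integral>x. indicator {..- (b / c)} (- (b / c) + (- b) * x)
      * (exp (- (b / c) + (- b) * x) / (- (b / c) + (- b) * x)) \<partial>lborel)"
    unfolding Ei_def set_lebesgue_integral_def
    using b by (subst lborel_integral_real_affine[where c = "- b" and t = "- (b / c)"]) auto
  also have "\<dots> = (\<integral>x. b * (indicator {..- (b / c)} (- (b / c) + (- b) * x)
      * (exp (- (b / c) + (- b) * x) / (- (b / c) + (- b) * x))) \<partial>lborel)"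
    by (rule integral_mult_right_zero[symmetric])
  also have "\<dots> = (\<integral>x. - exp (- (b / c)) * (exponential_density b x * (c / (b * (1 + c * x)))) \<partial>lborel)"
  proof (rule Bochner_Integration.integral_cong[OF refl])
    fix x
    show "b * (indicator {..- (b / c)} (- (b / c) + (- b) * x)
        * (exp (- (b / c) + (- b) * x) / (- (b / c) + (- b) * x)))
      = - exp (- (b / c)) * (exponential_density b x * (c / (b * (1 + c * x))))"
    proof (cases "x \<ge> 0")
      case True
      then have "1 + c * x > 0" using c by (simp add: add_pos_nonneg)
      moreover have "indicator {..- (b / c)} (- (b / c) + (- b) * x) = (1 :: real)"
        using True b by simp
      moreover have "- (b / c) + (- b) * x = - (b * (1 + c * x) / c)"
        using c by (simp add: field_simps)
      moreover have "exp (- (b / c) + (- b) * x) = exp (- (b / c)) * exp (- (x * b))"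
        by (simp add: exp_add[symmetric] mult.commute)
      ultimately show ?thesis
        using True b c by (simp only: exponential_density_def) simp
    next
      \<comment> \<open>For x < 0 the point t lies to the right of - b / c, so the indicator and the
        density are both 0.\<close>
      case False
      then have "indicator {..- (b / c)} (- (b / c) + (- b) * x) = (0 :: real)"
        using b by (simp add: mult_le_0_iff zero_le_mult_iff not_le)
      then show ?thesis
        using False by (simp only: exponential_density_def) simp
    qed
  qed
  also have "\<dots> = - exp (- (b / c)) * (\<integral>x. exponential_density b x * (c / (b * (1 + c * x))) \<partial>lborel)"
    by (rule integral_mult_right_zero)
  finally show ?thesis
    by (simp add: exp_Ei_def exp_minus)
qed

text \<open>Independence makes the joint law the product of the marginal laws. Fubini then
  integrates over Y first, turning the indicator into a probability at fixed x.\<close>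

lemma (in prob_space) indep_var_less:
  fixes X Y :: "'a \<Rightarrow> real" and \<phi> :: "real \<Rightarrow> real"
  assumes ind: "indep_var borel X borel Y"
    and [measurable]: "\<phi> \<in> borel_measurable borel"
    and int: "integrable M (\<lambda>\<omega>. \<phi> (X \<omega>))"
  shows integrable_indep_var_less: "integrable M (\<lambda>\<omega>. \<phi> (X \<omega>) * indicator {..<X \<omega>} (Y \<omega>))"
    and expectation_indep_var_less:
      "expectation (\<lambda>\<omega>. \<phi> (X \<omega>) * indicator {..<X \<omega>} (Y \<omega>)) =
       expectation (\<lambda>\<omega>. \<phi> (X \<omega>) * prob (Y -` {..<X \<omega>} \<inter> space M))"
proof -
  have [measurable]: "random_variable borel X" "random_variable borel Y"
    and joint: "distr M borel X \<Otimes>\<^sub>M distr M borel Y = distr M (borel \<Otimes>\<^sub>M borel) (\<lambda>\<omega>. (X \<omega>, Y \<omega>))"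
    using ind by (auto simp: indep_var_distribution_eq)
  let ?h = "\<lambda>(x, y). \<phi> x * indicator {..<x} y :: real"
  \<comment> \<open>Written as a comparison of coordinates, the indicator of the moving set
    \<open>{..<x}\<close> is visibly jointly measurable.\<close>
  have h_eq: "?h = (\<lambda>z. \<phi> (fst z) * (if snd z < fst z then 1 else 0))"
    by (auto split: split_indicator)
  have h [measurable]: "?h \<in> borel_measurable (borel \<Otimes>\<^sub>M borel)"
    unfolding h_eq by measurable
  have hXY: "(\<lambda>\<omega>. \<phi> (X \<omega>) * indicator {..<X \<omega>} (Y \<omega>)) = (\<lambda>\<omega>. ?h (X \<omega>, Y \<omega>))"
    by simp
  show int_h: "integrable M (\<lambda>\<omega>. \<phi> (X \<omega>) * indicator {..<X \<omega>} (Y \<omega>))"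
    by (rule Bochner_Integration.integrable_bound[OF int])
       (unfold hXY, measurable, auto split: split_indicator)
  interpret DX: prob_space "distr M borel X" by (rule prob_space_distr) simp
  interpret DY: prob_space "distr M borel Y" by (rule prob_space_distr) simp
  interpret D: pair_prob_space "distr M borel X" "distr M borel Y" ..
  have "integrable (distr M borel X \<Otimes>\<^sub>M distr M borel Y) ?h"
    unfolding joint using int_h by (subst integrable_distr_eq) auto
  from D.integral_fst'[OF this]
  have "integral\<^sup>L (distr M borel X \<Otimes>\<^sub>M distr M borel Y) ?h =
      (\<integral>x. \<phi> x * measure (distr M borel Y) {..<x} \<partial>distr M borel X)"
    by simp
  also have "\<dots> = (\<integral>x. \<phi> x * prob (Y -` {..<x} \<inter> space M) \<partial>distr M borel X)"
    by (simp add: measure_distr)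
  also have "\<dots> = expectation (\<lambda>\<omega>. \<phi> (X \<omega>) * prob (Y -` {..<X \<omega>} \<inter> space M))"
  proof (rule integral_distr)
    \<comment> \<open>Monotone real functions are Borel, which provides the measurability for
      pulling the integral back from the law of X to M.\<close>
    have "mono (\<lambda>x. prob (Y -` {..<x} \<inter> space M))"
      by (auto intro!: monoI finite_measure_mono)
    from borel_measurable_mono[OF this]
    show "(\<lambda>x. \<phi> x * prob (Y -` {..<x} \<inter> space M)) \<in> borel_measurable borel"
      by measurable
  qed simp
  finally show "expectation (\<lambda>\<omega>. \<phi> (X \<omega>) * indicator {..<X \<omega>} (Y \<omega>)) =
       expectation (\<lambda>\<omega>. \<phi> (X \<omega>) * prob (Y -` {..<X \<omega>} \<inter> space M))"
    unfolding joint by (subst (asm) integral_distr) auto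
qed

text \<open>The law of Y has a density, so the single point x carries no mass and the strict
  inequality has the probability of the non-strict one.\<close>

lemma (in prob_space) exponential_distributedD_less:
  assumes D: "distributed M lborel Y (exponential_density m)" and m: "m > 0" and x: "x \<ge> 0"
  shows "prob (Y -` {..<x} \<inter> space M) = 1 - exp (- x * m)"
proof -
  have "emeasure M (Y -` {..<x} \<inter> space M) = emeasure M (Y -` {..x} \<inter> space M)"
    unfolding distributed_emeasure[OF D, of "{..<x}", simplified]
      distributed_emeasure[OF D, of "{..x}", simplified]
    by (rule nn_integral_cong_AE)
       (use AE_lborel_singleton[of x] in \<open>auto elim!: eventually_mono split: split_indicator\<close>)
  then have "prob (Y -` {..<x} \<inter> space M) = prob (Y -` {..x} \<inter> space M)"
    by (simp add: measure_def)
  also have "Y -` {..x} \<inter> space M = {\<omega> \<in> space M. Y \<omega> \<le> x}"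
    by auto
  finally show ?thesis
    using exponential_distributedD_le[OF D x m] by simp
qed

lemma (in prob_space) exponential_less:
  fixes X Y :: "'a \<Rightarrow> real" and \<phi> :: "real \<Rightarrow> real"
  assumes l: "l > 0" and m: "m > 0"
    and X: "distributed M lborel X (exponential_density l)"
    and Y: "distributed M lborel Y (exponential_density m)"
    and ind: "indep_var borel X borel Y"
    and \<phi> [measurable]: "\<phi> \<in> borel_measurable borel"
    and int: "integrable lborel (\<lambda>x. exponential_density l x * \<phi> x)"
      "integrable lborel (\<lambda>x. exponential_density (l + m) x * \<phi> x)"
  shows integrable_exponential_less: "integrable M (\<lambda>\<omega>. \<phi> (X \<omega>) * indicator {..<X \<omega>} (Y \<omega>))"
    and expectation_exponential_less:
      "expectation (\<lambda>\<omega>. \<phi> (X \<omega>) * indicator {..<X \<omega>} (Y \<omega>)) =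
       (\<integral>x. exponential_density l x * \<phi> x \<partial>lborel)
       - l / (l + m) * (\<integral>x. exponential_density (l + m) x * \<phi> x \<partial>lborel)"
proof -
  have intX: "integrable M (\<lambda>\<omega>. \<phi> (X \<omega>))"
    using int(1) l by (subst (asm) distributed_integrable[OF X]) auto
  show "integrable M (\<lambda>\<omega>. \<phi> (X \<omega>) * indicator {..<X \<omega>} (Y \<omega>))"
    by (rule integrable_indep_var_less[OF ind \<phi> intX])
  have [measurable]: "random_variable borel Y"
    using ind by (auto simp: indep_var_distribution_eq)
  have "mono (\<lambda>x. prob (Y -` {..<x} \<inter> space M))"
    by (auto intro!: monoI finite_measure_mono)
  note [measurable] = borel_measurable_mono[OF this]
  \<comment> \<open>For x \<ge> 0 the probability is 1 - exp (- m x), and l exp (- (l + m) x) is l /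
    (l + m) times the density of rate l + m. For x < 0 both densities vanish.\<close>
  have dens: "exponential_density l x * (\<phi> x * prob (Y -` {..<x} \<inter> space M)) =
      exponential_density l x * \<phi> x - l / (l + m) * (exponential_density (l + m) x * \<phi> x)" for x
  proof (cases "x \<ge> 0")
    case True
    have "exp (- (x * (l + m))) = exp (- (x * l)) * exp (- (x * m))"
      by (simp add: exp_add[symmetric] algebra_simps)
    then show ?thesis
      using True l m exponential_distributedD_less[OF Y m True]
      by (simp add: exponential_density_def) (simp add: field_simps)
  qed (simp add: exponential_density_def)
  have "expectation (\<lambda>\<omega>. \<phi> (X \<omega>) * indicator {..<X \<omega>} (Y \<omega>)) =
      (\<integral>x. exponential_density l x * (\<phi> x * prob (Y -` {..<x} \<inter> space M)) \<partial>lborel)"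
    unfolding expectation_indep_var_less[OF ind \<phi> intX]
    using l by (subst distributed_integral[OF X]) auto
  also have "\<dots> = (\<integral>x. exponential_density l x * \<phi> x \<partial>lborel)
       - l / (l + m) * (\<integral>x. exponential_density (l + m) x * \<phi> x \<partial>lborel)"
    unfolding dens using int by simp
  finally show "expectation (\<lambda>\<omega>. \<phi> (X \<omega>) * indicator {..<X \<omega>} (Y \<omega>)) = \<dots>" .
qed

theorem proposition3p4:
  fixes M :: "'a measure" and X Y R :: "'a \<Rightarrow> real"
    and k kbar :: nat
    and lam alpha sigma :: "nat \<Rightarrow> real"
    and p_s p_w :: real
  assumes "prob_space M"
    and "k \<in> {1, 2}" and "kbar \<in> {1, 2}" and "kbar \<noteq> k"
    and "lam k > 0" and "lam kbar > 0"
    and "distributed M lborel X (exponential_density (lam k))"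
    and "distributed M lborel Y (exponential_density (lam kbar))"
    and "prob_space.indep_var M borel X borel Y"
    and "(sigma k)\<^sup>2 > 0" and "p_s > 0" and "p_w > 0"
    and "0 < alpha k" and "alpha k \<le> 1"
  defines "R \<equiv> \<lambda>\<omega>. oma_rate (alpha k) ((sigma k)\<^sup>2) p_s p_w (X \<omega>) (Y \<omega>)"
  shows "integrable M R \<and>
    prob_space.expectation M R =
      alpha k / ln 2 *
        (- exp_Ei (lam k * alpha k * (sigma k)\<^sup>2 / p_s)
         + lam k / (lam k + lam kbar) * exp_Ei ((lam k + lam kbar) * alpha k * (sigma k)\<^sup>2 / p_s)
         - lam k / (lam k + lam kbar) * exp_Ei ((lam k + lam kbar) * alpha k * (sigma k)\<^sup>2 / p_w))"
proof -
  interpret prob_space M by fact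
  let ?l = "lam k" and ?m = "lam kbar"
  let ?\<phi> = "\<lambda>p x. alpha k / ln 2 * ln (1 + p / (alpha k * (sigma k)\<^sup>2) * x)"
  \<comment> \<open>The rate at weak power is taken everywhere and replaced by the rate at strong
    power on the event Y < X. A tie keeps the weak power, which matches the strict set
    \<open>{..<X \<omega>}\<close>.\<close>
  have R: "R = (\<lambda>\<omega>. ?\<phi> p_w (X \<omega>)
      + ?\<phi> p_s (X \<omega>) * indicator {..<X \<omega>} (Y \<omega>) - ?\<phi> p_w (X \<omega>) * indicator {..<X \<omega>} (Y \<omega>))"
    unfolding R_def oma_rate_def log_def by (auto split: split_indicator)
  have ln_pair: "integrable lborel (\<lambda>x. exponential_density b x * ?\<phi> p x)"
      "(\<integral>x. exponential_density b x * ?\<phi> p x \<partial>lborel) =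
        - (alpha k / ln 2 * exp_Ei (b * alpha k * (sigma k)\<^sup>2 / p))"
    if b: "b > 0" and p: "p > 0" for b p
  proof -
    \<comment> \<open>With this signal-to-noise slope, the argument \<open>b / ?c\<close> of
      \<open>exp_Ei\<close> is the one in the claimed formula.\<close>
    let ?c = "p / (alpha k * (sigma k)\<^sup>2)"
    have c: "?c > 0"
      using p assms(10,13) by (intro divide_pos_pos mult_pos_pos)
    have eq: "exponential_density b x * ?\<phi> p x
        = alpha k / ln 2 * (exponential_density b x * ln (1 + ?c * x))" for x
      by (simp add: ac_simps)
    show "integrable lborel (\<lambda>x. exponential_density b x * ?\<phi> p x)"
      unfolding eq by (rule integrable_mult_right, rule integrable_exponential_density_ln[OF b c])
    have "b / ?c = b * alpha k * (sigma k)\<^sup>2 / p"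
      by simp
    then show "(\<integral>x. exponential_density b x * ?\<phi> p x \<partial>lborel) =
        - (alpha k / ln 2 * exp_Ei (b * alpha k * (sigma k)\<^sup>2 / p))"
      unfolding eq integral_mult_right_zero integral_exponential_density_ln[OF b c]
      using exp_Ei_eq_integral[OF b c] by (simp only: mult_minus_right minus_minus)
  qed
  have pos: "?l + ?m > 0" using assms(5,6) by simp
  have \<phi>: "?\<phi> p \<in> borel_measurable borel" for p
    by measurable
  have less:
    "integrable M (\<lambda>\<omega>. ?\<phi> p (X \<omega>) * indicator {..<X \<omega>} (Y \<omega>))"
    "expectation (\<lambda>\<omega>. ?\<phi> p (X \<omega>) * indicator {..<X \<omega>} (Y \<omega>)) =
      - (alpha k / ln 2 * exp_Ei (?l * alpha k * (sigma k)\<^sup>2 / p))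
      - ?l / (?l + ?m) * - (alpha k / ln 2 * exp_Ei ((?l + ?m) * alpha k * (sigma k)\<^sup>2 / p))"
    if p: "p > 0" for p
    using integrable_exponential_less[OF assms(5-9) \<phi> ln_pair(1)[OF assms(5) p] ln_pair(1)[OF pos p]]
      expectation_exponential_less[OF assms(5-9) \<phi> ln_pair(1)[OF assms(5) p] ln_pair(1)[OF pos p]]
    unfolding ln_pair(2)[OF assms(5) p] ln_pair(2)[OF pos p] by - assumption+
  have total: "integrable M (\<lambda>\<omega>. ?\<phi> p_w (X \<omega>))"
    "expectation (\<lambda>\<omega>. ?\<phi> p_w (X \<omega>)) =
      - (alpha k / ln 2 * exp_Ei (?l * alpha k * (sigma k)\<^sup>2 / p_w))"
    using distributed_integrable[OF assms(7), of "?\<phi> p_w"] distributed_integral[OF assms(7), of "?\<phi> p_w"]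
      ln_pair[OF assms(5,12)] assms(5) \<phi> by simp_all
  have "integrable M R"
    unfolding R using less(1)[OF assms(11)] less(1)[OF assms(12)] total(1)
    by (intro Bochner_Integration.integrable_add Bochner_Integration.integrable_diff)
  moreover have "expectation R = expectation (\<lambda>\<omega>. ?\<phi> p_w (X \<omega>))
      + expectation (\<lambda>\<omega>. ?\<phi> p_s (X \<omega>) * indicator {..<X \<omega>} (Y \<omega>))
      - expectation (\<lambda>\<omega>. ?\<phi> p_w (X \<omega>) * indicator {..<X \<omega>} (Y \<omega>))"
    unfolding R using less(1)[OF assms(11)] less(1)[OF assms(12)] total(1)
    by (subst Bochner_Integration.integral_diff Bochner_Integration.integral_add;
        (intro Bochner_Integration.integrable_add)?)+ auto
  ultimately show ?thesis
    \<comment> \<open>The \<open>exp_Ei\<close> terms of rate \<open>?l\<close> at power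
      \<open>p_w\<close>, one from the total and one from the subtracted part, cancel; only the term
      of rate \<open>?l + ?m\<close> survives for the weak power.\<close>
    unfolding total(2) less(2)[OF assms(11)] less(2)[OF assms(12)]
    by (simp add: algebra_simps)
qed

end
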